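(* Let $q$ be a power of a prime, let $n$ be a positive integer, and let $r$ be an integer with $1\le r\le n$. Let $\mathcal{M}$ be a constant rank $r$ subspace of $M_n(\mathbb{F}_q)$. Suppose that $q\ge r+1$. Then $\dim_{\mathbb{F}_q}\mathcal{M}\le n$.
   Context: $\mathbb{F}_q$ denotes the finite field of order $q$, and $M_n(K)$ denotes the $K$-vector space of $n\times n$ matrices with entries in a field $K$. A non-zero $K$-subspace $\mathcal{M}$ of $M_n(K)$ is called a constant rank $r$ subspace if every non-zero element of $\mathcal{M}$ has rank exactly $r$. *)

theory Defs
  imports "Jordan_Normal_Form.DL_Rank" "HOL-Number_Theory.Prime_Powers"
begin

definition constant_rank_subspace :: "nat \<Rightarrow> nat \<Rightarrow> 'a::field mat set \<Rightarrow> bool" where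
  "constant_rank_subspace n r M \<longleftrightarrow>
     VectorSpace.subspace class_ring M (module_mat TYPE('a) n n) \<and>
     M \<noteq> {0\<^sub>m n n} \<and>
     (\<forall>A\<in>M. A \<noteq> 0\<^sub>m n n \<longrightarrow> vec_space.rank n A = r)"

definition mat_subspace_dim :: "nat \<Rightarrow> 'a::field mat set \<Rightarrow> nat" where
  "mat_subspace_dim n M =
     vectorspace.dim class_ring ((module_mat TYPE('a) n n)\<lparr>carrier := M\<rparr>)"

end

theory Submission
  imports Defs "HOL-Library.Cardinality" "HOL-Library.Function_Algebras"
begin

text \<open>
  Let \<open>A\<close>, \<open>B\<close> lie in the subspace \<open>M\<close> with \<open>A \<noteq> 0\<close>. All members of the pencil \<open>s A + B\<close>
  have rank at most \<open>r\<close>; since the field has more than \<open>r\<close> elements, this forces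
  \<open>B (ker A) \<subseteq> im A\<close>. Suppose now \<open>|M| > q^n\<close>. Then every vector \<open>x\<close> is killed by some nonzero
  \<open>A \<in> M\<close>, hence \<open>{B x | B \<in> M} \<subseteq> im A\<close> has at most \<open>q^r\<close> elements and \<open>x\<close> is killed by at least
  \<open>|M| / q^r\<close> members of \<open>M\<close>. Counting the pairs \<open>(A, x)\<close> with \<open>A x = 0\<close> in two ways, where every
  nonzero \<open>A\<close> has a kernel of size \<open>q^(n - r)\<close>, yields \<open>|M| \<le> q^n\<close>, a contradiction.
\<close>

section \<open>Counting along the fibres of an additive map\<close>

text \<open>Every non-empty fibre is a translate of the kernel. As \<open>S\<close> need only be
  finite and closed under differences, it can be a space of vectors or a set of linear maps that are
  evaluated at a fixed vector.\<close>

lemma card_eq_card_kernel_times_card_image: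
  fixes f :: "'a::ab_group_add \<Rightarrow> 'b::ab_group_add"
  assumes "finite S" and diff: "\<And>x y. x \<in> S \<Longrightarrow> y \<in> S \<Longrightarrow> x - y \<in> S"
    and hom: "\<And>x y. x \<in> S \<Longrightarrow> y \<in> S \<Longrightarrow> f (x - y) = f x - f y"
  shows "card S = card {x \<in> S. f x = 0} * card (f ` S)"
proof -
  have fibre: "card {x \<in> S. f x = f y} = card {x \<in> S. f x = 0}" if "y \<in> S" for y
  proof (rule bij_betw_same_card)
    show "bij_betw (\<lambda>x. x - y) {x \<in> S. f x = f y} {x \<in> S. f x = 0}"
    proof (rule bij_betw_byWitness[where f' = "\<lambda>x. x + y"])
      have "x + y \<in> S \<and> f (x + y) = f y" if x: "x \<in> S" "f x = 0" for x
      proof -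
        have "0 - y \<in> S" using diff[OF diff[OF \<open>y \<in> S\<close> \<open>y \<in> S\<close>] \<open>y \<in> S\<close>] by simp
        then have "x + y \<in> S" using diff[OF x(1), of "0 - y"] by simp
        with hom[OF this \<open>y \<in> S\<close>] x show ?thesis by simp
      qed
      then show "(\<lambda>x. x + y) ` {x \<in> S. f x = 0} \<subseteq> {x \<in> S. f x = f y}" by auto
    qed (use diff hom that in auto)
  qed
  have "card S = (\<Sum>z \<in> f ` S. card {x \<in> S. f x = z})"
    using sum.image_gen[OF \<open>finite S\<close>, of "\<lambda>_. 1::nat" f] by simp
  also have "\<dots> = (\<Sum>z \<in> f ` S. card {x \<in> S. f x = 0})"
    by (rule sum.cong) (auto simp: fibre)
  finally show ?thesis by simp
qed

section \<open>Kernels and images in a pencil of linear maps\<close>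

text \<open>
  If \<open>g x \<notin> f ` S\<close>, then for every \<open>s\<close> the map \<open>(w, c) \<mapsto> (s f + g) (h w + c x)\<close>, where \<open>h\<close> is
  a linear right inverse of \<open>f\<close>, has a nontrivial zero \<open>(w\<^sub>s, c\<^sub>s)\<close> for cardinality reasons. Modulo
  \<open>g x\<close>, the \<open>w\<^sub>s\<close> are eigenvectors of \<open>g \<circ> h\<close> with distinct eigenvalues \<open>- s\<close>; their
  independence makes \<open>f ` S\<close> too large.
\<close>
lemma image_of_kernel_in_image:
  fixes scale :: "'a::{field,finite} \<Rightarrow> 'b::ab_group_add \<Rightarrow> 'b"
  assumes "vector_space scale"
    and linf: "Vector_Spaces.linear scale scale f" and ling: "Vector_Spaces.linear scale scale g"
    and S: "module.subspace scale S" "finite S"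
    and pencil: "\<And>s. card ((\<lambda>v. scale s (f v) + g v) ` S) \<le> card (f ` S)"
    and small: "card (f ` S) < CARD('a) ^ CARD('a)"
    and x: "x \<in> S" "f x = 0"
  shows "g x \<in> f ` S"
proof (rule ccontr)
  assume gx: "g x \<notin> f ` S"
  interpret vector_space scale by fact
  interpret vector_space_pair scale scale by unfold_locales
  interpret f: Vector_Spaces.linear scale scale f by fact
  interpret g: Vector_Spaces.linear scale scale g by fact
  have R: "subspace (f ` S)" using f.subspace_image S(1) .
  obtain h where h: "range h \<subseteq> S" "Vector_Spaces.linear scale scale h" "\<forall>v \<in> f ` S. f (h v) = v"
    using linear_exists_right_inverse_on[OF linf S(1)] by (elim exE conjE)
  interpret h: Vector_Spaces.linear scale scale h by fact
  have "\<exists>w c. w \<in> f ` S \<and> w \<noteq> 0 \<and> scale s w + g (h w) + scale c (g x) = 0" for s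
  proof -
    define p where "p = (\<lambda>(w, c). scale s w + g (h w) + scale c (g x))"
    \<comment> \<open>Because \<open>f x = 0\<close>, the map \<open>f\<close> sends
      \<open>h w + scale c x\<close> to \<open>w\<close>, so \<open>p\<close> evaluates the pencil
      at that vector. By \<open>pencil\<close> it then takes at most as many values as
      \<open>f\<close> does on \<open>S\<close>, while its domain is \<open>CARD('a)\<close> times
      larger.\<close>
    have "p ` (f ` S \<times> UNIV) \<subseteq> (\<lambda>v. scale s (f v) + g v) ` S"
    proof (clarsimp simp: p_def)
      fix v c assume v: "v \<in> S"
      let ?u = "h (f v) + scale c x"
      have "?u \<in> S" using h(1) x(1) S(1) by (auto intro!: subspace_add subspace_scale)
      moreover have "scale s (f ?u) + g ?u = scale s (f v) + g (h (f v)) + scale c (g x)"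
        using v h(3) x(2) by (simp add: f.add f.scale g.add g.scale)
      ultimately show "scale s (f v) + g (h (f v)) + scale c (g x) \<in> (\<lambda>v. scale s (f v) + g v) ` S"
        by (metis (no_types, lifting) imageI)
    qed
    then have "card (p ` (f ` S \<times> UNIV)) \<le> card ((\<lambda>v. scale s (f v) + g v) ` S)"
      using S(2) by (intro card_mono) auto
    also have "\<dots> \<le> card (f ` S)" by (rule pencil)
    also have "\<dots> < card (f ` S) * CARD('a)"
    proof -
      have "card (f ` S) > 0" using x S(2) by (auto simp: card_gt_0_iff)
      moreover have "CARD('a) > 1"
        using card_mono[of UNIV "{0, 1 :: 'a}"] by simp
      ultimately show ?thesis by simp
    qed
    also have "\<dots> = card (f ` S \<times> (UNIV :: 'a set))" by (simp add: card_cartesian_product)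
    finally have "\<not> inj_on p (f ` S \<times> UNIV)" using pigeonhole by blast
    then obtain a b where ab: "a \<in> f ` S \<times> UNIV" "b \<in> f ` S \<times> UNIV" "p a = p b" "a \<noteq> b"
      by (meson inj_onI)
    define w c where "w = fst a - fst b" and "c = snd a - snd b"
    have "scale s w + g (h w) + scale c (g x) = p a - p b"
      unfolding p_def w_def c_def
      by (simp add: case_prod_unfold g.diff h.diff scale_right_diff_distrib scale_left_diff_distrib)
    then have eq: "scale s w + g (h w) + scale c (g x) = 0" using ab by simp
    have wR: "w \<in> f ` S" unfolding w_def using ab by (intro subspace_diff[OF R]) (auto simp only: mem_Times_iff)
    have "w \<noteq> 0"
    proof
      assume w0: "w = 0"
      then have "scale c (g x) = 0" using eq by (simp add: g.zero h.zero)
      moreover have "c \<noteq> 0" using ab(4) w0 by (auto simp: w_def c_def prod_eq_iff)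
      ultimately have "g x = 0" by simp
      then show False using gx subspace_0[OF R] by simp
    qed
    with wR eq show ?thesis by blast
  qed
  then obtain w c where wR: "\<And>s. w s \<in> f ` S" and w0: "\<And>s. w s \<noteq> 0"
    and eq: "\<And>s. scale s (w s) + g (h (w s)) + scale (c s) (g x) = 0" by metis
  \<comment> \<open>Apply \<open>g\<close> after \<open>h\<close> to the relation: by
    \<open>eq\<close>, up to sign, each coefficient gets multiplied by \<open>s\<close> and a
    multiple of \<open>g x\<close> appears. That multiple lies in the image of \<open>f\<close> on
    \<open>S\<close>, whereas \<open>g x\<close> does not, so its coefficient vanishes.\<close>
  have shift: "(\<Sum>s\<in>UNIV. scale (s * a s) (w s)) = 0" if a: "(\<Sum>s\<in>UNIV. scale (a s) (w s)) = 0" for a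
  proof -
    let ?z = "\<Sum>s\<in>UNIV. scale (s * a s) (w s)" and ?c = "\<Sum>s\<in>UNIV. a s * c s"
    have zR: "?z \<in> f ` S" by (intro subspace_sum[OF R] subspace_scale[OF R] wR)
    have "0 = (\<Sum>s\<in>UNIV. scale (a s) (scale s (w s) + g (h (w s)) + scale (c s) (g x)))"
      by (simp add: eq)
    also have "\<dots> = ?z + g (h (\<Sum>s\<in>UNIV. scale (a s) (w s))) + scale ?c (g x)"
      by (simp add: scale_right_distrib sum.distrib g.sum h.sum g.scale h.scale scale_sum_left
          mult.commute)
    finally have z: "?z = - scale ?c (g x)" using a by (simp add: g.zero h.zero eq_neg_iff_add_eq_0)
    have "?c = 0"
    proof (rule ccontr)
      assume "?c \<noteq> 0"
      then have "g x = scale (- inverse ?c) ?z" unfolding z by simp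
      then show False using gx subspace_scale[OF R zR] by metis
    qed
    with z show ?thesis by simp
  qed
  \<comment> \<open>Iterating \<open>shift\<close> multiplies the coefficient at \<open>s\<close> by
    the value at \<open>s\<close> of the polynomial with root set \<open>U\<close>.\<close>
  have prod: "(\<Sum>s\<in>UNIV. scale ((\<Prod>u\<in>U. s - u) * a s) (w s)) = 0"
    if "(\<Sum>s\<in>UNIV. scale (a s) (w s)) = 0" "finite U" for a U
    using that(2)
  proof (induction U)
    case empty then show ?case using that by simp
  next
    case (insert u U)
    let ?b = "\<lambda>s. (\<Prod>u\<in>U. s - u) * a s"
    have "scale ((\<Prod>u\<in>insert u U. s - u) * a s) (w s)
        = scale (s * ?b s) (w s) - scale u (scale (?b s) (w s))" for s
      using insert(1,2) by (simp add: left_diff_distrib mult.assoc flip: scale_left_diff_distrib)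
    then have "(\<Sum>s\<in>UNIV. scale ((\<Prod>u\<in>insert u U. s - u) * a s) (w s))
       = (\<Sum>s\<in>UNIV. scale (s * ?b s) (w s)) - scale u (\<Sum>s\<in>UNIV. scale (?b s) (w s))"
      by (simp only: sum_subtractf scale_sum_right)
    then show ?case using shift[OF insert.IH] insert.IH by simp
  qed
  \<comment> \<open>As in Lagrange interpolation, taking all elements except \<open>t\<close> as
    roots leaves only the term at \<open>t\<close>.\<close>
  have indep: "a t = 0" if "(\<Sum>s\<in>UNIV. scale (a s) (w s)) = 0" for a t
  proof -
    have "(\<Sum>s\<in>UNIV. scale ((\<Prod>u\<in>UNIV - {t}. s - u) * a s) (w s))
        = (\<Sum>s\<in>UNIV. if s = t then scale ((\<Prod>u\<in>UNIV - {t}. t - u) * a t) (w t) else 0)"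
      by (intro sum.cong) (auto simp: prod_zero_iff)
    then have "scale ((\<Prod>u\<in>UNIV - {t}. t - u) * a t) (w t) = 0"
      using prod[OF that, of "UNIV - {t}"] by simp
    then show ?thesis using w0[of t] by (auto simp: prod_zero_iff)
  qed
  \<comment> \<open>Independence makes all \<open>CARD('a) ^ CARD('a)\<close> linear combinations
    distinct, and all lie in the image of \<open>f\<close> on \<open>S\<close>, against
    \<open>small\<close>.\<close>
  have "inj (\<lambda>a. \<Sum>s\<in>UNIV. scale (a s) (w s))"
  proof (rule injI)
    fix a b assume "(\<Sum>s\<in>UNIV. scale (a s) (w s)) = (\<Sum>s\<in>UNIV. scale (b s) (w s))"
    then have "(\<Sum>s\<in>UNIV. scale (a s - b s) (w s)) = 0"
      by (simp add: scale_left_diff_distrib sum_subtractf)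
    from indep[OF this] show "a = b" by (auto simp: fun_eq_iff)
  qed
  moreover have "range (\<lambda>a. \<Sum>s\<in>UNIV. scale (a s) (w s)) \<subseteq> f ` S"
    by (auto intro!: subspace_sum[OF R] subspace_scale[OF R] wR)
  ultimately have "CARD('a \<Rightarrow> 'a) \<le> card (f ` S)"
    using card_inj_on_le[of _ UNIV "f ` S"] S(2) by blast
  then show False using small by (simp add: card_fun)
qed

section \<open>Double counting of maps and the vectors they kill\<close>

text \<open>This is the counting argument without dimensions: \<open>E\<close> stands for the
  coordinate space, \<open>L\<close> for the matrices as maps, and \<open>R\<close> for the number
  of vectors in the image of a non-zero one.\<close>

lemma card_constant_image_size_le:
  fixes scale :: "'a::{field,finite} \<Rightarrow> 'b::ab_group_add \<Rightarrow> 'b" and L :: "('b \<Rightarrow> 'b) set"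
  assumes "vector_space scale"
    and E: "module.subspace scale E" "finite E"
    and L: "finite L" "L \<noteq> {}" "\<And>f. f \<in> L \<Longrightarrow> Vector_Spaces.linear scale scale f"
      "\<And>f x. f \<in> L \<Longrightarrow> x \<in> E \<Longrightarrow> f x \<in> E"
      "\<And>f g c. f \<in> L \<Longrightarrow> g \<in> L \<Longrightarrow> (\<lambda>x. scale c (f x) + g x) \<in> L"
    and R: "\<And>f. f \<in> L \<Longrightarrow> f \<noteq> 0 \<Longrightarrow> card (f ` E) = R" "1 < R" "R < CARD('a) ^ CARD('a)"
  shows "card L \<le> card E"
proof (rule ccontr)
  assume "\<not> card L \<le> card E"
  then have less: "card E < card L" by simp
  interpret vector_space scale by fact
  have lin_simps: "f (x - y) = f x - f y" "f 0 = 0" if "f \<in> L" for f x y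
  proof -
    interpret f: Vector_Spaces.linear scale scale f using L(3) that .
    show "f (x - y) = f x - f y" "f 0 = 0" by (simp_all add: f.diff f.zero)
  qed
  have minus: "f - g \<in> L" if "f \<in> L" "g \<in> L" for f g
    using L(5)[OF that(2,1), of "-1"] by (simp add: fun_diff_def)
  then have zero: "0 \<in> L" using L(2) by (metis diff_self ex_in_conv)
  have zE: "0 \<in> E" using subspace_0[OF E(1)] .
  let ?K = "\<lambda>f. card {x \<in> E. f x = 0}" and ?A = "\<lambda>x. card {f \<in> L. f x = 0}"
  have K: "?K f * R = card E" if "f \<in> L - {0}" for f
    using card_eq_card_kernel_times_card_image[of E f] that R(1) E lin_simps
    by (auto simp: subspace_diff)
  have A: "card L \<le> ?A x * R" if x: "x \<in> E" for x
  proof -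
    let ?I = "(\<lambda>f. f x) ` L"
    have D: "card L = ?A x * card ?I"
      by (rule card_eq_card_kernel_times_card_image) (use L(1) minus in auto)
    have "card ?I \<le> card E" using x L(4) E(2) by (intro card_mono) auto
    \<comment> \<open>If only one map killed \<open>x\<close>, evaluation at \<open>x\<close> would
      be injective on \<open>L\<close> and give \<open>card L \<le> card E\<close>.\<close>
    then have "?A x \<noteq> 1" using D less by auto
    then have "{f \<in> L. f x = 0} \<noteq> {0}" by auto
    then obtain f where f: "f \<in> L" "f x = 0" "f \<noteq> 0" using zero by auto
    have "g x \<in> f ` E" if g: "g \<in> L" for g
    proof (rule image_of_kernel_in_image[OF \<open>vector_space scale\<close> L(3)[OF f(1)] L(3)[OF g] E])
      fix s
      show "card ((\<lambda>v. scale s (f v) + g v) ` E) \<le> card (f ` E)"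
      \<comment> \<open>A member of the pencil is again in \<open>L\<close>, so it is zero or has
        exactly \<open>R\<close> values on \<open>E\<close>.\<close>
      proof (cases "(\<lambda>v. scale s (f v) + g v) = 0")
        case True
        then have "(\<lambda>v. scale s (f v) + g v) ` E = {0}" using zE by (auto simp: fun_eq_iff)
        then show ?thesis using R f by simp
      next
        case False
        then show ?thesis using R(1)[OF L(5)[OF f(1) g, of s]] R(1) f by simp
      qed
    qed (use R f x in auto)
    then have "card ?I \<le> card (f ` E)" using E(2) by (intro card_mono) auto
    then show ?thesis using D R(1) f by simp
  qed
  have "(\<Sum>f\<in>L. ?K f) = (\<Sum>f\<in>L. \<Sum>x\<in>E. if f x = 0 then 1 else 0)"
    using E(2) by (simp add: sum.If_cases Int_def)
  also have "\<dots> = (\<Sum>x\<in>E. \<Sum>f\<in>L. if f x = 0 then 1 else 0)" by (rule sum.swap)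
  also have "\<dots> = (\<Sum>x\<in>E. ?A x)"
    using L(1) by (simp add: sum.If_cases Int_def)
  finally have swap: "(\<Sum>f\<in>L. ?K f) * R = (\<Sum>x\<in>E. ?A x) * R" by simp
  have "(\<Sum>f\<in>L. ?K f) * R = ?K 0 * R + (\<Sum>f\<in>L - {0}. ?K f * R)"
    using L(1) zero by (simp add: sum.remove[of L 0] sum_distrib_right add_mult_distrib)
  also have "?K 0 * R + (\<Sum>f\<in>L - {0}. ?K f * R) = card E * R + (card L - 1) * card E"
    using K zero L(1) by (simp add: card_Diff_singleton)
  finally have left: "(\<Sum>f\<in>L. ?K f) * R = card E * R + (card L - 1) * card E" .
  \<comment> \<open>The zero vector is killed by all of \<open>L\<close>, so its term is known
    exactly; the bound \<open>A\<close> serves for the other vectors.\<close>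
  have A0: "{f \<in> L. f 0 = 0} = L" using lin_simps by auto
  have "card L * R + (card E - 1) * card L = card L * R + (\<Sum>x\<in>E - {0}. card L)"
    using zE E(2) by (simp add: card_Diff_singleton)
  also have "\<dots> \<le> card L * R + (\<Sum>x\<in>E - {0}. ?A x * R)"
    using A by (intro add_left_mono sum_mono) auto
  also have "\<dots> = (\<Sum>x\<in>E. ?A x) * R"
    using E(2) zE A0 by (simp add: sum.remove[of E 0] sum_distrib_right add_mult_distrib)
  finally have "card L * R + (card E - 1) * card L \<le> card E * R + (card L - 1) * card E"
    using left swap by simp
  \<comment> \<open>Cancelling \<open>card L * card E\<close> leaves
    \<open>(R - 1) * card L \<le> (R - 1) * card E\<close>, and \<open>R - 1\<close> is positive.
    Successors replace the truncated subtractions.\<close>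
  moreover obtain d where d: "card L = Suc d" using less by (cases "card L") auto
  moreover obtain e where e: "card E = Suc e" using zE E(2) by (cases "card E") auto
  moreover obtain k where "R = Suc (Suc k)" using R(2) that[of "R - 2"] by simp
  ultimately have "d * Suc k \<le> e * Suc k" by (simp add: algebra_simps)
  then have "d \<le> e" by (simp only: mult_le_cancel2)
  then show False using less d e by simp
qed

section \<open>Cardinality and dimension\<close>

text \<open>Coordinates in a basis are a bijection onto the scalar functions on that basis. This
  translates between dimensions and the cardinalities used in the counting.\<close>

lemma (in vectorspace) card_carrier_eq_power_dim:
  assumes "finite (carrier V)" "finite (carrier K)"
  shows "card (carrier V) = card (carrier K) ^ dim"
proof -
  have "fin_dim" unfolding fin_dim_def using assms(1) span_is_subset2[of "carrier V"] in_own_span[of "carrier V"]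
    by (intro exI[of _ "carrier V"]) auto
  then obtain B where B: "finite B" "basis B" using finite_basis_exists by blast
  then have BV: "B \<subseteq> carrier V" by (simp add: basis_def)
  have crit: "\<forall>v\<in>carrier V. \<exists>!a. a \<in> B \<rightarrow>\<^sub>E carrier K \<and> lincomb a B = v"
    using basis_criterion[OF B(1) BV] B(2) by simp
  have "bij_betw (\<lambda>a. lincomb a B) (B \<rightarrow>\<^sub>E carrier K) (carrier V)"
    unfolding bij_betw_def
  proof
    have cl: "lincomb a B \<in> carrier V" if "a \<in> B \<rightarrow>\<^sub>E carrier K" for a
      using that BV by (intro lincomb_closed) auto
    show "inj_on (\<lambda>a. lincomb a B) (B \<rightarrow>\<^sub>E carrier K)"
    proof (rule inj_onI)
      fix a b assume ab: "a \<in> B \<rightarrow>\<^sub>E carrier K" "b \<in> B \<rightarrow>\<^sub>E carrier K" "lincomb a B = lincomb b B"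
      show "a = b" using bspec[OF crit cl[OF ab(2)]] ab by (auto dest: ex1_implies_ex)
    qed
    show "(\<lambda>a. lincomb a B) ` (B \<rightarrow>\<^sub>E carrier K) = carrier V"
    proof
      show "carrier V \<subseteq> (\<lambda>a. lincomb a B) ` (B \<rightarrow>\<^sub>E carrier K)"
        using bspec[OF crit] by (metis (no_types, lifting) imageI subsetI)
    qed (use cl in auto)
  qed
  then have "card (carrier V) = card (B \<rightarrow>\<^sub>E carrier K)" by (simp add: bij_betw_same_card)
  then show ?thesis using B by (simp add: card_PiE dim_basis)
qed


section \<open>Vectors and matrices as functions on the naturals\<close>

text \<open>
  Vectors of dimension \<open>n\<close> are extended by zero to functions on \<open>nat\<close>, because the type of all
  vectors (of any dimension) is not a group, whereas the function space is.
\<close>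
definition vec_fun :: "'a::zero vec \<Rightarrow> nat \<Rightarrow> 'a" where
  "vec_fun v = (\<lambda>i. if i < dim_vec v then v $ i else 0)"

text \<open>The argument is cut down to its first \<open>dim_col A\<close> coordinates, which makes
  the map linear on the whole function space, as \<open>Vector_Spaces.linear\<close>
  demands.\<close>

definition mat_fun :: "'a::semiring_0 mat \<Rightarrow> (nat \<Rightarrow> 'a) \<Rightarrow> nat \<Rightarrow> 'a" where
  "mat_fun A f = vec_fun (A *\<^sub>v vec (dim_col A) f)"

definition fun_scale :: "'a::times \<Rightarrow> (nat \<Rightarrow> 'a) \<Rightarrow> nat \<Rightarrow> 'a" where
  "fun_scale c f = (\<lambda>i. c * f i)"

lemma vector_space_fun_scale: "vector_space (fun_scale :: 'a::field \<Rightarrow> _)"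
  by unfold_locales (auto simp: fun_scale_def algebra_simps)

lemma vec_vec_fun [simp]: "v \<in> carrier_vec n \<Longrightarrow> vec n (vec_fun v) = v"
  by (auto simp: vec_fun_def)

lemma vec_fun_add: "v \<in> carrier_vec n \<Longrightarrow> w \<in> carrier_vec n \<Longrightarrow>
    vec_fun (v + w) = vec_fun v + (vec_fun w :: nat \<Rightarrow> 'a::monoid_add)"
  by (auto simp: vec_fun_def)

lemma vec_fun_smult: "vec_fun (c \<cdot>\<^sub>v v) = fun_scale c (vec_fun v :: nat \<Rightarrow> 'a::mult_zero)"
  by (auto simp: vec_fun_def fun_scale_def)

lemma inj_on_vec_fun: "inj_on vec_fun (carrier_vec n)"
  by (rule inj_on_inverseI[of _ "vec n"]) simp

lemma mat_fun_vec_fun: "A \<in> carrier_mat m n \<Longrightarrow> v \<in> carrier_vec n \<Longrightarrow> mat_fun A (vec_fun v) = vec_fun (A *\<^sub>v v)"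
  by (simp add: mat_fun_def)

lemma linear_mat_fun: "Vector_Spaces.linear fun_scale fun_scale (mat_fun (A :: 'a::field mat))"
proof -
  interpret vector_space "fun_scale :: 'a \<Rightarrow> _" by (rule vector_space_fun_scale)
  have A: "A \<in> carrier_mat (dim_row A) (dim_col A)" by simp
  have 1: "vec (dim_col A) (f + g) = vec (dim_col A) f + vec (dim_col A) g" for f g :: "nat \<Rightarrow> 'a"
    by auto
  have 2: "vec (dim_col A) (fun_scale c f) = c \<cdot>\<^sub>v vec (dim_col A) f" for c and f :: "nat \<Rightarrow> 'a"
    by (auto simp: fun_scale_def)
  show ?thesis
    by unfold_locales
      (simp_all add: mat_fun_def 1 2 mult_add_distrib_mat_vec[OF A] mult_mat_vec[OF A]
        vec_fun_add[OF mult_mat_vec_carrier[OF A] mult_mat_vec_carrier[OF A]] vec_fun_smult)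
qed

lemma mat_fun_add:
  assumes "A \<in> carrier_mat m n" "B \<in> carrier_mat m n"
  shows "mat_fun (A + B) = mat_fun A + (mat_fun B :: _ \<Rightarrow> nat \<Rightarrow> 'a::comm_semiring_0)"
  using assms by (auto simp: mat_fun_def add_mult_distrib_mat_vec[of _ m n] vec_fun_add[of _ m])

lemma mat_fun_smult: "mat_fun (c \<cdot>\<^sub>m A) f = fun_scale c (mat_fun (A :: 'a::comm_ring_1 mat) f)"
  by (auto simp: mat_fun_def vec_fun_def fun_scale_def)

text \<open>The entries of column \<open>j\<close> are read off from the image of the unit vector
  \<open>j\<close>. Hence passing from matrices to maps preserves cardinalities.\<close>

lemma inj_on_mat_fun: "inj_on (mat_fun :: 'a::comm_semiring_1 mat \<Rightarrow> _) (carrier_mat m n)"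
proof (rule inj_onI)
  fix A B :: "'a mat"
  assume AB: "A \<in> carrier_mat m n" "B \<in> carrier_mat m n" "mat_fun A = mat_fun B"
  show "A = B"
  proof (rule eq_matI)
    fix i j assume ij: "i < dim_row B" "j < dim_col B"
    have "C $$ (i, j) = mat_fun C (vec_fun (unit_vec n j)) i" if "C \<in> carrier_mat m n" for C :: "'a mat"
      using that ij AB by (subst mat_fun_vec_fun[OF that]) (auto simp: vec_fun_def)
    from this[OF AB(1)] this[OF AB(2)] AB(3) show "A $$ (i, j) = B $$ (i, j)" by simp
  qed (use AB in auto)
qed

section \<open>Cardinalities over a finite field\<close>

lemma finite_carrier_vec: "finite (carrier_vec n :: 'a::finite vec set)"
proof (rule finite_subset)
  show "carrier_vec n \<subseteq> vec_of_list ` {xs :: 'a list. set xs \<subseteq> UNIV \<and> length xs = n}"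
    by (auto intro!: image_eqI[of _ _ "list_of_vec _"] simp: vec_list)
qed (intro finite_imageI finite_lists_length_eq finite)

lemma finite_carrier_mat: "finite (carrier_mat m n :: 'a::finite mat set)"
proof (rule finite_subset)
  show "carrier_mat m n \<subseteq> mat_of_rows n ` {vs :: 'a vec list. set vs \<subseteq> carrier_vec n \<and> length vs = m}"
  proof
    fix A :: "'a mat" assume "A \<in> carrier_mat m n"
    then show "A \<in> mat_of_rows n ` {vs. set vs \<subseteq> carrier_vec n \<and> length vs = m}"
      using rows_carrier[of A] by (intro image_eqI[of _ _ "rows A"]) auto
  qed
qed (simp add: finite_lists_length_eq finite_carrier_vec)

lemma card_carrier_vec: "card (carrier_vec n :: 'a::{field,finite} vec set) = CARD('a) ^ n"
proof -
  interpret vec_space "TYPE('a)" n .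
  show ?thesis
    using vectorspace.card_carrier_eq_power_dim[OF vec_vs[where 'a = 'a], of n] dim_is_n
    by (simp add: finite_carrier_vec class_ring_simps module_vec_simps)
qed

text \<open>The image is the column space, whose dimension is the rank. Constant rank thus becomes
  constant image size.\<close>

lemma card_mat_image:
  fixes A :: "'a::{field,finite} mat"
  assumes A: "A \<in> carrier_mat m n"
  shows "card ((\<lambda>v. A *\<^sub>v v) ` carrier_vec n) = CARD('a) ^ vec_space.rank m A"
proof -
  interpret vec_space "TYPE('a)" m .
  have cols: "set (cols A) \<subseteq> carrier_vec m" using cols_dim[of A] A by simp
  have "vectorspace class_ring (span_vs (set (cols A)))"
    by (rule subspace_is_vs[OF span_is_subspace[OF cols]])
  from vectorspace.card_carrier_eq_power_dim[OF this] 
  have "card (span (set (cols A))) = CARD('a) ^ rank A"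
    using finite_subset[OF _ finite_carrier_vec, of "span (set (cols A))" m] span_closed[OF cols]
    by (auto simp: rank_def class_ring_simps)
  moreover have "(\<lambda>v. A *\<^sub>v v) ` carrier_vec n = col_space A"
    using col_space_eq[OF A] A by auto
  ultimately show ?thesis by (simp add: col_space_def)
qed

section \<open>The dimension bound for constant rank subspaces\<close>

theorem theorem1:
  fixes q n r :: nat and M :: "'a::{field,finite} mat set"
  assumes "primepow q" and "card (UNIV :: 'a set) = q"
    and "n \<ge> 1" and "1 \<le> r" and "r \<le> n"
    and "constant_rank_subspace n r M"
    and "q \<ge> r + 1"
  shows "mat_subspace_dim n M \<le> n"
proof -
  let ?V = "module_mat TYPE('a) n n"
  have q: "CARD('a) = q" by fact
  then have q1: "q > 1" using assms by simp
  from assms(6) have sub: "VectorSpace.subspace class_ring M ?V"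
    and rank: "\<And>A. A \<in> M \<Longrightarrow> A \<noteq> 0\<^sub>m n n \<Longrightarrow> vec_space.rank n A = r"
    by (auto simp: constant_rank_subspace_def)
  interpret mv: vectorspace "class_ring :: 'a ring" ?V by (rule matrix_vs)
  have submod: "submodule class_ring M ?V" using sub by (simp add: subspace_def)
  have M: "M \<subseteq> carrier_mat n n" "0\<^sub>m n n \<in> M"
      "\<And>A B. A \<in> M \<Longrightarrow> B \<in> M \<Longrightarrow> A + B \<in> M" "\<And>c A. A \<in> M \<Longrightarrow> c \<cdot>\<^sub>m A \<in> M"
    using submod unfolding submodule_def by (auto simp: module_mat_simps class_ring_simps)
  have finM: "finite M" using M(1) finite_carrier_mat by (rule finite_subset)
  have cardM: "card M = q ^ mat_subspace_dim n M"
    using vectorspace.card_carrier_eq_power_dim[OF mv.subspace_is_vs[OF sub]] finM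
    by (simp add: mat_subspace_dim_def class_ring_simps q)
  let ?E = "vec_fun ` (carrier_vec n :: 'a vec set)"
  interpret vector_space "fun_scale :: 'a \<Rightarrow> _" by (rule vector_space_fun_scale)
  \<comment> \<open>The two sides are \<open>q ^ mat_subspace_dim n M\<close> and
    \<open>q ^ n\<close>, so comparing exponents gives the claim.\<close>
  have "card (mat_fun ` M) \<le> card ?E"
  proof (rule card_constant_image_size_le[OF vector_space_fun_scale, where R = "q ^ r"])
    show "subspace ?E"
    proof (rule subspaceI)
      show "0 \<in> ?E" by (rule image_eqI[of _ _ "0\<^sub>v n"]) (auto simp: vec_fun_def)
    qed (auto simp flip: vec_fun_add vec_fun_smult)
    show "f x \<in> ?E" if "f \<in> mat_fun ` M" "x \<in> ?E" for f x
      using that M(1) by (fastforce simp: mat_fun_vec_fun)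
    show "(\<lambda>x. fun_scale c (f x) + g x) \<in> mat_fun ` M" if "f \<in> mat_fun ` M" "g \<in> mat_fun ` M" for f g c
    proof -
      from that obtain A B where AB: "f = mat_fun A" "g = mat_fun B" "A \<in> M" "B \<in> M" by auto
      then have "mat_fun (c \<cdot>\<^sub>m A + B) = mat_fun (c \<cdot>\<^sub>m A) + mat_fun B"
        using M(1) by (intro mat_fun_add[of _ n n]) auto
      also have "\<dots> = (\<lambda>x. fun_scale c (f x) + g x)"
        by (simp add: AB mat_fun_smult plus_fun_def)
      finally show ?thesis using AB M(3,4) by (metis imageI)
    qed
    show "card (f ` ?E) = q ^ r" if f: "f \<in> mat_fun ` M" "f \<noteq> 0" for f
    proof -
      from f obtain A where A: "f = mat_fun A" "A \<in> M" by auto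
      then have Ac: "A \<in> carrier_mat n n" using M(1) by auto
      have "mat_fun (0\<^sub>m n n) = (0 :: _ \<Rightarrow> _ \<Rightarrow> 'a)"
        by (rule ext) (auto simp: mat_fun_def vec_fun_def)
      then have r: "vec_space.rank n A = r" using f A rank by auto
      have "f ` ?E = vec_fun ` (\<lambda>v. A *\<^sub>v v) ` carrier_vec n"
        using mat_fun_vec_fun[OF Ac] by (simp add: A image_image)
      then have "card (f ` ?E) = card ((\<lambda>v. A *\<^sub>v v) ` carrier_vec n)"
        using Ac by (auto intro!: card_image inj_on_subset[OF inj_on_vec_fun[of n]])
      then show ?thesis by (simp add: card_mat_image[OF Ac] r q)
    qed
    show "1 < q ^ r" using q1 assms(4) by (intro one_less_power) auto
    \<comment> \<open>Here the bound \<open>q \<ge> r + 1\<close> enters: an image of dimension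
      \<open>r\<close> has no room for \<open>q\<close> independent vectors.\<close>
    show "q ^ r < CARD('a) ^ CARD('a)" using q1 assms(7) unfolding q by (simp add: power_strict_increasing)
  qed (use finM M(2) finite_carrier_vec linear_mat_fun in auto)
  also have "card ?E = q ^ n"
    by (simp add: card_image[OF inj_on_vec_fun] card_carrier_vec q)
  also have "card (mat_fun ` M) = q ^ mat_subspace_dim n M"
    using card_image[OF inj_on_subset[OF inj_on_mat_fun M(1)]] cardM by simp
  finally show ?thesis by (rule power_le_imp_le_exp[OF q1])
qed

end
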